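(* Let $a,b,c,n,x_0,y_0\in\mathbb{R}$ with $n\ne0$, $\Delta:=\sqrt{b^2-4ac}>0$ and $a,b,c,\Delta\in\mathbb{Z}$; let $h$ be the hyperbola $a(x-x_0)^2+b(x-x_0)(y-y_0)+c(y-y_0)^2=n$ and let $H$ be the closure of one of the convex connected components of $\mathbb{R}^2\setminus h$. Then, for each of the two asymptotes of $h$, each of the $\lfloor(|n|/\Delta)^{1/3}\rfloor$ lines that are parallel to that asymptote, contain points of $\mathbb{Z}^2$, intersect $H$, and are closest to the asymptote among such lines, contains a vertex of $\mathrm{conv}(H\cap\mathbb{Z}^2)$. Hence \[ \#\,\mathrm{vert}(\mathrm{conv}(H\cap\mathbb{Z}^2))\ge 2\left(\frac{|n|}{\Delta}\right)^{1/3}-2. \]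
   Context: $\mathrm{conv}$ denotes convex hull, $\mathrm{vert}$ the set of vertices, $\#$ cardinality. *)

theory Defs
  imports "HOL-Analysis.Analysis"
begin

definition hyperbola :: "real \<Rightarrow> real \<Rightarrow> real \<Rightarrow> real \<Rightarrow> real \<Rightarrow> real \<Rightarrow> (real \<times> real) set" where
  "hyperbola a b c n x0 y0 =
    {(x, y). a * (x - x0)\<^sup>2 + b * (x - x0) * (y - y0) + c * (y - y0)\<^sup>2 = n}"

text \<open>The distance to the curve is required to vanish towards both ends of the line. Each
  asymptote of a hyperbola is approached at both of its ends, by one branch at each.\<close>

definition asymptote_of :: "(real \<times> real) set \<Rightarrow> (real \<times> real) set \<Rightarrow> bool"
    (infix "asymptote'_of" 50) where
  "A asymptote_of h \<longleftrightarrow> affine A \<and> aff_dim A = 1 \<and>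
     ((\<lambda>p. infdist p h) \<longlongrightarrow> 0) (inf at_infinity (principal A))"

definition lattice_lines :: "(real \<times> real) set \<Rightarrow> (real \<times> real) set \<Rightarrow> (real \<times> real) set set" where
  "lattice_lines A H =
    {L. affine_parallel A L \<and> L \<inter> \<int> \<times> \<int> \<noteq> {} \<and> L \<inter> H \<noteq> {}}"

definition closest_members ::
    "nat \<Rightarrow> (real \<times> real) set \<Rightarrow> (real \<times> real) set set \<Rightarrow> (real \<times> real) set set \<Rightarrow> bool" where
  "closest_members k A F S \<longleftrightarrow> S \<subseteq> F \<and> finite S \<and> card S = k \<and>
     (\<forall>L\<in>S. \<forall>L'\<in>F - S. setdist A L \<le> setdist A L')"

definition vert :: "(real \<times> real) set \<Rightarrow> (real \<times> real) set" where
  "vert P = {v. v extreme_point_of P}"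

end

theory Submission imports Defs begin

text \<open>
  Over the rationals the quadratic form splits as \<open>k * (w1 \<bullet> z) * (w2 \<bullet> z)\<close> with \<open>w1\<close> and \<open>w2\<close>
  primitive integer vectors and \<open>\<Delta> = \<bar>k\<bar> D\<close>, \<open>D = \<bar>det (w1, w2)\<bar>\<close>. In the coordinates
  \<open>X = w1 \<bullet> (z - z0)\<close>, \<open>Y = w2 \<bullet> (z - z0)\<close> the region \<open>H\<close> becomes \<open>X > 0, X Y \<ge> m\<close> with
  \<open>m = \<bar>n\<bar> / \<bar>k\<bar>\<close>, the lattice lines parallel to the asymptote \<open>X = 0\<close> have spacing \<open>1\<close>, and on
  each of them the lattice points have \<open>Y\<close>-spacing \<open>D\<close>. The second difference of \<open>m / X\<close> at
  \<open>X = d\<close> exceeds \<open>2 m / d^3\<close>, so for \<open>d^3 D \<le> m\<close> the lowest lattice point of \<open>H\<close> on the line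
  \<open>X = d\<close> lies strictly below the chord of the curve over \<open>[d - 1, d + 1]\<close> and hence is a vertex.
  A vertex counted for both asymptotes would have \<open>m \<le> X Y \<le> N^2\<close> with \<open>N = \<lfloor>(m / D)^(1/3)\<rfloor>\<close>,
  which is impossible for \<open>m > D\<close>. There are finitely many vertices since moving a vertex by
  \<open>D\<close> in either coordinate direction has to leave \<open>H\<close>.
\<close>

section \<open>Primitive integer vectors and the branch in linear coordinates\<close>

definition primitive :: "real \<times> real \<Rightarrow> bool" where
  "primitive w \<longleftrightarrow> (\<exists>p q::int. coprime p q \<and> w = (real_of_int p, real_of_int q))"

definition det2 :: "real \<times> real \<Rightarrow> real \<times> real \<Rightarrow> real" where
  "det2 w1 w2 = fst w1 * snd w2 - snd w1 * fst w2"

text \<open>Only the sign of the first factor is prescribed: for \<open>m > 0\<close> it forces the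
  sign of the second. Negating both vectors gives the opposite branch, so one definition serves for
  both.\<close>

definition open_branch :: "real \<times> real \<Rightarrow> real \<times> real \<Rightarrow> real \<times> real \<Rightarrow> real \<Rightarrow> (real \<times> real) set" where
  "open_branch w1 w2 z0 m = {z. 0 < w1 \<bullet> (z - z0) \<and> m < (w1 \<bullet> (z - z0)) * (w2 \<bullet> (z - z0))}"

definition branch :: "real \<times> real \<Rightarrow> real \<times> real \<Rightarrow> real \<times> real \<Rightarrow> real \<Rightarrow> (real \<times> real) set" where
  "branch w1 w2 z0 m = {z. 0 < w1 \<bullet> (z - z0) \<and> m \<le> (w1 \<bullet> (z - z0)) * (w2 \<bullet> (z - z0))}"

lemma primitive_imp_lattice: "primitive w \<Longrightarrow> w \<in> \<int> \<times> \<int>"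
  by (auto simp: primitive_def)

lemma primitive_uminus: "primitive w \<Longrightarrow> primitive (- w)"
  unfolding primitive_def
proof (elim exE conjE)
  fix p q :: int assume "coprime p q" "w = (real_of_int p, real_of_int q)"
  then show "\<exists>p q::int. coprime p q \<and> - w = (real_of_int p, real_of_int q)"
    by (intro exI[of _ "- p"] exI[of _ "- q"]) auto
qed

lemma primitive_nonzero: "primitive w \<Longrightarrow> w \<noteq> 0"
  by (auto simp: primitive_def zero_prod_def)

lemma inner_lattice_Ints:
  fixes w z :: "real \<times> real"
  shows "w \<in> \<int> \<times> \<int> \<Longrightarrow> z \<in> \<int> \<times> \<int> \<Longrightarrow> w \<bullet> z \<in> \<int>"
  by (auto simp: inner_prod_def)

text \<open>A Bezout identity for the coordinates of \<open>w\<close>, scaled by \<open>k\<close>.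
  It puts lattice points on every integer level of \<open>w\<close>, so that the parallel lattice
  lines are equally spaced.\<close>

lemma primitive_inner_surj:
  assumes "primitive w" "k \<in> \<int>"
  obtains z where "z \<in> \<int> \<times> \<int>" "w \<bullet> z = k"
proof -
  obtain p q :: int where pq: "coprime p q" "w = (real_of_int p, real_of_int q)"
    using assms(1) by (auto simp: primitive_def)
  obtain j :: int where j: "k = real_of_int j" using assms(2) by (auto elim: Ints_cases)
  obtain u v where "u * p + v * q = 1"
    using bezout_int[of p q] pq(1) by auto
  then have "p * (u * j) + q * (v * j) = j"
    by (metis distrib_right mult.commute mult.left_commute mult_1)
  then have "real_of_int p * of_int (u * j) + real_of_int q * of_int (v * j) = real_of_int j"
    by (metis of_int_add of_int_mult)
  then have "w \<bullet> (real_of_int (u * j), real_of_int (v * j)) = k"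
    using pq(2) j by (simp add: inner_prod_def)
  then show ?thesis by (intro that) auto
qed

text \<open>Coprimality makes the quarter turn of \<open>w\<close> a generator of all lattice points
  orthogonal to \<open>w\<close>; it fixes the spacing of lattice points on a level line.\<close>

lemma primitive_orthogonal_lattice:
  assumes "primitive w" "z \<in> \<int> \<times> \<int>" "w \<bullet> z = 0"
  obtains k :: int where "z = real_of_int k *\<^sub>R (- snd w, fst w)"
proof -
  obtain p q :: int where pq: "coprime p q" "w = (real_of_int p, real_of_int q)"
    using assms(1) by (auto simp: primitive_def)
  obtain x y :: int where z: "z = (real_of_int x, real_of_int y)"
    using assms(2) by (auto elim!: Ints_cases)
  have "real_of_int (p * x + q * y) = 0"
    using assms(3) pq z by (simp add: inner_prod_def)
  then have eq: "p * x + q * y = 0" by linarith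
  obtain u v where uv: "u * p + v * q = 1"
    using bezout_int[of p q] pq(1) by auto
  \<comment> \<open>If \<open>(x, y)\<close> is \<open>k\<close> times \<open>(- q, p)\<close>, then
    \<open>u * y - v * x = k * (u * p + v * q) = k\<close>.\<close>
  define k where "k = u * y - v * x"
  have "x = - (k * q)"
  proof -
    have "x + k * q = x * (1 - (u * p + v * q)) + u * (p * x + q * y)"
      by (simp add: k_def algebra_simps)
    then show ?thesis using uv eq by simp
  qed
  moreover have "y = k * p"
  proof -
    have "y - k * p = y * (1 - (u * p + v * q)) + v * (p * x + q * y)"
      by (simp add: k_def algebra_simps)
    then show ?thesis using uv eq by simp
  qed
  ultimately show ?thesis using z pq(2) by (intro that[of k]) auto
qed

lemma nonzero_lattice_multiple_primitive:
  assumes "z \<in> \<int> \<times> \<int>" "z \<noteq> (0::real \<times> real)"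
  obtains g w where "primitive w" "g \<noteq> 0" "z = g *\<^sub>R w"
proof -
  obtain x y :: int where z: "z = (real_of_int x, real_of_int y)"
    using assms(1) by (auto elim!: Ints_cases)
  then have g: "gcd x y \<noteq> 0" using assms(2) by (auto simp: zero_prod_def)
  then obtain x' y' where "x = x' * gcd x y" "y = y' * gcd x y" "coprime x' y'"
    using gcd_coprime_exists by blast
  then have "z = real_of_int (gcd x y) *\<^sub>R (real_of_int x', real_of_int y')"
    using z by (metis mult.commute of_int_mult scaleR_Pair real_scaleR_def)
  then show ?thesis
    using g \<open>coprime x' y'\<close> 
    by (intro that[of "(real_of_int x', real_of_int y')" "real_of_int (gcd x y)"])
       (auto simp: primitive_def)
qed

section \<open>Factorization of the quadratic form\<close>

text \<open>As \<Delta> is an integer, the two linear factors can be taken with integer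
  coefficients, and dividing each by its content makes them primitive. The discriminant of
  \<open>k\<close> times a product of two linear forms is the square of \<open>k\<close> times their
  determinant, which yields the formula for \<Delta>.\<close>

lemma quadratic_form_factorization:
  fixes a b c \<Delta> :: real
  assumes "\<Delta> = sqrt (b\<^sup>2 - 4 * a * c)" "\<Delta> > 0" "a \<in> \<int>" "b \<in> \<int>" "c \<in> \<int>" "\<Delta> \<in> \<int>"
  obtains w1 w2 k where "primitive w1" "primitive w2" "k \<noteq> 0" "\<Delta> = \<bar>k\<bar> * \<bar>det2 w1 w2\<bar>"
    "\<And>u v. a * u\<^sup>2 + b * u * v + c * v\<^sup>2 = k * (w1 \<bullet> (u, v)) * (w2 \<bullet> (u, v))"
proof -
  have disc: "\<Delta>\<^sup>2 = b\<^sup>2 - 4 * a * c"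
    using assms(1,2) by (simp add: real_sqrt_gt_0_iff)
  have "\<exists>z1 z2 k. z1 \<in> \<int> \<times> \<int> \<and> z2 \<in> \<int> \<times> \<int> \<and> z1 \<noteq> 0 \<and> z2 \<noteq> 0 \<and> k \<noteq> 0 \<and>
     (\<forall>u v. a * u\<^sup>2 + b * u * v + c * v\<^sup>2 = k * (z1 \<bullet> (u, v)) * (z2 \<bullet> (u, v)))"
  proof (cases "a = 0")
    case True
    then have "b \<noteq> 0" using disc assms(2) by auto
    then show ?thesis using True assms
      by (intro exI[of _ "(0, 1)"] exI[of _ "(b, c)"] exI[of _ 1])
         (auto simp: inner_prod_def zero_prod_def algebra_simps power2_eq_square)
  next
    case False
    \<comment> \<open>Completing the square: \<open>4 * a\<close> times the form is the difference
      of the squares of \<open>2 * a * u + b * v\<close> and \<open>\<Delta> * v\<close>.\<close>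
    have "a * u\<^sup>2 + b * u * v + c * v\<^sup>2 =
        1 / (4 * a) * ((2 * a, b + \<Delta>) \<bullet> (u, v)) * ((2 * a, b - \<Delta>) \<bullet> (u, v))" for u v
    proof -
      have "((2 * a, b + \<Delta>) \<bullet> (u, v)) * ((2 * a, b - \<Delta>) \<bullet> (u, v)) =
          4 * a\<^sup>2 * u\<^sup>2 + 4 * a * b * u * v + (b\<^sup>2 - \<Delta>\<^sup>2) * v\<^sup>2"
        by (simp add: inner_prod_def algebra_simps power2_eq_square)
      also have "\<dots> = 4 * a * (a * u\<^sup>2 + b * u * v + c * v\<^sup>2)"
        unfolding disc by (simp add: algebra_simps power2_eq_square)
      finally show ?thesis using False by (simp add: field_simps)
    qed
    then show ?thesis using False assms
      by (intro exI[of _ "(2 * a, b + \<Delta>)"] exI[of _ "(2 * a, b - \<Delta>)"] exI[of _ "1 / (4 * a)"])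
         (auto simp: zero_prod_def)
  qed
  then obtain z1 z2 k where z: "z1 \<in> \<int> \<times> \<int>" "z2 \<in> \<int> \<times> \<int>" "z1 \<noteq> 0" "z2 \<noteq> 0" "k \<noteq> 0"
    and eq: "\<And>u v. a * u\<^sup>2 + b * u * v + c * v\<^sup>2 = k * (z1 \<bullet> (u, v)) * (z2 \<bullet> (u, v))"
    by blast
  obtain g1 w1 where w1: "primitive w1" "g1 \<noteq> 0" "z1 = g1 *\<^sub>R w1"
    using nonzero_lattice_multiple_primitive z by metis
  obtain g2 w2 where w2: "primitive w2" "g2 \<noteq> 0" "z2 = g2 *\<^sub>R w2"
    using nonzero_lattice_multiple_primitive z by metis
  define l where "l = k * g1 * g2"
  have eq': "a * u\<^sup>2 + b * u * v + c * v\<^sup>2 = l * (w1 \<bullet> (u, v)) * (w2 \<bullet> (u, v))" for u v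
    unfolding eq l_def w1(3) w2(3) by simp
  \<comment> \<open>The values at \<open>(1, 0)\<close>, \<open>(0, 1)\<close> and
    \<open>(1, 1)\<close> recover the coefficients.\<close>
  have "a = l * fst w1 * fst w2" using eq'[of 1 0] by (simp add: inner_prod_def)
  moreover have "c = l * snd w1 * snd w2" using eq'[of 0 1] by (simp add: inner_prod_def)
  moreover have "a + b + c = l * (fst w1 + snd w1) * (fst w2 + snd w2)"
    using eq'[of 1 1] by (simp add: inner_prod_def)
  ultimately have abc: "a = l * fst w1 * fst w2" "c = l * snd w1 * snd w2"
     "b = l * (fst w1 * snd w2 + snd w1 * fst w2)"
    by (auto simp: algebra_simps)
  have "\<Delta>\<^sup>2 = (l * det2 w1 w2)\<^sup>2"
    unfolding disc abc det2_def by (simp add: algebra_simps power2_eq_square)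
  then have "\<Delta> = \<bar>l * det2 w1 w2\<bar>"
    using assms(2) by (metis abs_of_pos power2_eq_iff_nonneg abs_ge_zero power2_abs less_imp_le)
  then show ?thesis
    using w1 w2 z(5) eq' by (intro that[of w1 w2 l]) (auto simp: l_def abs_mult)
qed

section \<open>The two linear factors: symmetry and determinant\<close>

lemma branch_swap: "m > 0 \<Longrightarrow> branch w1 w2 z0 m = branch w2 w1 z0 m"
  unfolding branch_def
  by (auto simp: mult.commute) (metis less_le_trans zero_less_mult_pos zero_less_mult_pos2)+

lemma det2_swap: "\<bar>det2 w2 w1\<bar> = \<bar>det2 w1 w2\<bar>"
  by (simp add: det2_def algebra_simps)

lemma abs_det2_ge_1:
  assumes "w1 \<in> \<int> \<times> \<int>" "w2 \<in> \<int> \<times> \<int>" "det2 w1 w2 \<noteq> 0"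
  shows "1 \<le> \<bar>det2 w1 w2\<bar>"
proof -
  have "det2 w1 w2 \<in> \<int>" using assms by (auto simp: det2_def)
  then show ?thesis using assms(3) by (metis Ints_nonzero_abs_ge1)
qed

section \<open>Vertices on the lattice lines near an asymptote\<close>

text \<open>The point \<open>p\<close> together with the open half-space where the functional is
  larger is convex and contains \<open>S\<close>, hence contains the hull. The supporting hyperplane
  through \<open>p\<close> therefore meets the hull in \<open>p\<close> alone.\<close>

lemma unique_minimizer_extreme_point:
  fixes g p :: "'a::euclidean_space"
  assumes "p \<in> S" "\<And>x. x \<in> S \<Longrightarrow> x \<noteq> p \<Longrightarrow> g \<bullet> p < g \<bullet> x"
  shows "p extreme_point_of (convex hull S)"
proof -
  let ?T = "insert p {x. g \<bullet> p < g \<bullet> x}"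
  have "convex ?T"
  proof (rule convexI)
    fix x y :: 'a and u v :: real
    assume xy: "x \<in> ?T" "y \<in> ?T" and uv: "0 \<le> u" "0 \<le> v" "u + v = 1"
    show "u *\<^sub>R x + v *\<^sub>R y \<in> ?T"
    proof (cases "x = p \<and> y = p \<or> u = 0 \<or> v = 0")
      case True
      then show ?thesis using xy uv by (auto simp: scaleR_left_distrib[symmetric])
    next
      case False
      then have "u > 0" "v > 0" "g \<bullet> p \<le> g \<bullet> x" "g \<bullet> p \<le> g \<bullet> y" "g \<bullet> p < g \<bullet> x \<or> g \<bullet> p < g \<bullet> y"
        using xy uv by auto
      then have "u * (g \<bullet> p) + v * (g \<bullet> p) < u * (g \<bullet> x) + v * (g \<bullet> y)"
        by (metis add_le_less_mono add_less_le_mono mult_left_mono mult_strict_left_mono uv(1,2))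
      then show ?thesis
        using uv(3) by (simp add: inner_right_distrib distrib_right[symmetric])
    qed
  qed
  moreover have "S \<subseteq> ?T" using assms(2) by auto
  ultimately have sub: "convex hull S \<subseteq> ?T" by (simp add: hull_minimal)
  have "(convex hull S) \<inter> {x. g \<bullet> x = g \<bullet> p} = {p}"
    using sub assms(1) hull_inc[of p S convex] by auto
  moreover have "g \<bullet> p \<le> g \<bullet> x" if "x \<in> convex hull S" for x
    using sub that by auto
  ultimately show ?thesis
    by (rule extreme_point_of_Int_supporting_hyperplane_ge)
qed

text \<open>The lattice points on a level line of \<open>w1\<close> form a progression whose step, a
  quarter turn of \<open>w1\<close>, changes \<open>w2\<close> by the determinant up to sign.
  Rounding up the number of steps to height \<open>r\<close> finds the lowest point, which
  overshoots \<open>r\<close> by less than one step.\<close>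

lemma lowest_lattice_point:
  assumes w1: "primitive w1" and det: "det2 w1 w2 \<noteq> 0"
    and z: "z \<in> \<int> \<times> \<int>" "w1 \<bullet> (z - z0) = d"
  obtains p where "p \<in> \<int> \<times> \<int>" "w1 \<bullet> (p - z0) = d"
    "r \<le> w2 \<bullet> (p - z0)" "w2 \<bullet> (p - z0) < r + \<bar>det2 w1 w2\<bar>"
    "\<And>x. x \<in> \<int> \<times> \<int> \<Longrightarrow> w1 \<bullet> (x - z0) = d \<Longrightarrow> r \<le> w2 \<bullet> (x - z0) \<Longrightarrow> x \<noteq> p \<Longrightarrow>
       w2 \<bullet> (p - z0) < w2 \<bullet> (x - z0)"
proof -
  define D where "D = \<bar>det2 w1 w2\<bar>"
  have "D > 0" using det by (simp add: D_def)
  \<comment> \<open>The sign orients the step \<open>u\<close> so that \<open>w2\<close> increases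
    along it.\<close>
  define s where "s = sgn (det2 w1 w2)"
  have s: "s = 1 \<or> s = - 1" using det by (auto simp: s_def sgn_if)
  define u where "u = s *\<^sub>R (- snd w1, fst w1)"
  have w1u: "w1 \<bullet> u = 0" by (simp add: u_def inner_prod_def)
  have w2u: "w2 \<bullet> u = D"
    by (simp add: u_def s_def D_def inner_prod_def det2_def sgn_if abs_if algebra_simps)
  have u: "u \<in> \<int> \<times> \<int>"
    using primitive_imp_lattice[OF w1] s by (auto simp: u_def)
  have line: "\<exists>k::int. x - y = of_int k *\<^sub>R u"
    if "x \<in> \<int> \<times> \<int>" "y \<in> \<int> \<times> \<int>" "w1 \<bullet> (x - z0) = w1 \<bullet> (y - z0)" for x y
  proof -
    have "x - y \<in> \<int> \<times> \<int>" "w1 \<bullet> (x - y) = 0"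
      using that by (auto simp: inner_diff_right)
    then obtain k :: int where k: "x - y = of_int k *\<^sub>R (- snd w1, fst w1)"
      by (rule primitive_orthogonal_lattice[OF w1])
    show ?thesis
    proof (cases "s = 1")
      case True
      then show ?thesis using k by (auto simp: u_def)
    next
      case False
      then show ?thesis using s k by (intro exI[of _ "- k"]) (auto simp: u_def)
    qed
  qed
  define j where "j = \<lceil>(r - w2 \<bullet> (z - z0)) / D\<rceil>"
  define p where "p = z + of_int j *\<^sub>R u"
  have p: "p \<in> \<int> \<times> \<int>" using z(1) u by (auto simp: p_def mem_Times_iff)
  have w1p: "w1 \<bullet> (p - z0) = d"
    using z(2) w1u by (simp add: p_def inner_diff_right inner_add_right)
  have w2p: "w2 \<bullet> (p - z0) = w2 \<bullet> (z - z0) + of_int j * D"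
    using w2u by (simp add: p_def inner_diff_right inner_add_right)
  have "(r - w2 \<bullet> (z - z0)) / D \<le> of_int j" "of_int j < (r - w2 \<bullet> (z - z0)) / D + 1"
    unfolding j_def by linarith+
  then have j: "r - w2 \<bullet> (z - z0) \<le> of_int j * D" "of_int j * D < r - w2 \<bullet> (z - z0) + D"
    using \<open>D > 0\<close> by (simp_all add: field_simps)
  show ?thesis
  proof (rule that[OF p w1p])
    show "r \<le> w2 \<bullet> (p - z0)" "w2 \<bullet> (p - z0) < r + \<bar>det2 w1 w2\<bar>"
      using j w2p unfolding D_def[symmetric] by linarith+
    fix x assume x: "x \<in> \<int> \<times> \<int>" "w1 \<bullet> (x - z0) = d" "r \<le> w2 \<bullet> (x - z0)" "x \<noteq> p"
    obtain k :: int where k: "x - p = of_int k *\<^sub>R u"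
      using line[OF x(1) p] x(2) w1p by auto
    have w2x: "w2 \<bullet> (x - z0) = w2 \<bullet> (p - z0) + of_int k * D"
      using arg_cong[OF k, of "(\<bullet>) w2"] w2u by (simp add: inner_diff_right)
    have "k \<noteq> 0" using k x(4) by auto
    \<comment> \<open>One step below \<open>p\<close> is already below \<open>r\<close>, as
      \<open>p\<close> is less than \<open>D\<close> above \<open>r\<close>.\<close>
    moreover have "k > - 1"
    proof (rule ccontr)
      assume "\<not> k > - 1"
      then have "of_int k * D \<le> - 1 * D"
        using \<open>D > 0\<close> by (intro mult_right_mono) auto
      then show False using w2x x(3) j w2p by linarith
    qed
    ultimately have "of_int k * D > 0" using \<open>D > 0\<close> by simp
    then show "w2 \<bullet> (p - z0) < w2 \<bullet> (x - z0)" using w2x by simp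
  qed
qed

text \<open>The vertex is the unique minimizer of a functional
  \<open>\<alpha> X + \<beta> Y\<close>. Its choice depends on whether there is another lattice line
  between this one and the asymptote, that is, on whether \<open>d > 1\<close>.\<close>

lemma lattice_line_contains_vertex:
  assumes w1: "primitive w1" and det: "det2 w1 w2 \<noteq> 0" and "m > 0"
    and d: "d > 0" "d ^ 3 * \<bar>det2 w1 w2\<bar> \<le> m"
    and z: "z \<in> \<int> \<times> \<int>" "w1 \<bullet> (z - z0) = d"
  shows "\<exists>p. p \<in> vert (convex hull (branch w1 w2 z0 m \<inter> \<int> \<times> \<int>)) \<and> w1 \<bullet> (p - z0) = d"
proof -
  let ?S = "branch w1 w2 z0 m \<inter> \<int> \<times> \<int>"
  let ?D = "\<bar>det2 w1 w2\<bar>"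
  obtain p where p: "p \<in> \<int> \<times> \<int>" "w1 \<bullet> (p - z0) = d"
      "m / d \<le> w2 \<bullet> (p - z0)" "w2 \<bullet> (p - z0) < m / d + ?D"
    and low: "\<And>x. x \<in> \<int> \<times> \<int> \<Longrightarrow> w1 \<bullet> (x - z0) = d \<Longrightarrow> m / d \<le> w2 \<bullet> (x - z0) \<Longrightarrow> x \<noteq> p \<Longrightarrow>
       w2 \<bullet> (p - z0) < w2 \<bullet> (x - z0)"
    using lowest_lattice_point[OF w1 det z, where r = "m / d"] by blast
  have pS: "p \<in> ?S" using p d by (auto simp: branch_def field_simps)
  define f where "f = w2 \<bullet> (p - z0)"
  have "f > 0" using p(3) d \<open>m > 0\<close> unfolding f_def by (smt (verit) divide_pos_pos)
  have S: "0 < w1 \<bullet> (x - z0)" "m / (w1 \<bullet> (x - z0)) \<le> w2 \<bullet> (x - z0)" "0 < w2 \<bullet> (x - z0)"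
    if "x \<in> ?S" for x
  proof -
    show *: "0 < w1 \<bullet> (x - z0)" using that by (auto simp: branch_def)
    show **: "m / (w1 \<bullet> (x - z0)) \<le> w2 \<bullet> (x - z0)"
      using that * by (auto simp: branch_def field_simps)
    show "0 < w2 \<bullet> (x - z0)" using * ** \<open>m > 0\<close> by (smt (verit) divide_pos_pos)
  qed
  have gap: "\<bar>w1 \<bullet> (x - z0) - d\<bar> \<ge> 1" if "x \<in> ?S" "w1 \<bullet> (x - z0) \<noteq> d" for x
  proof -
    have "w1 \<bullet> (x - p) \<in> \<int>"
      using that(1) p(1) primitive_imp_lattice[OF w1] by (intro inner_lattice_Ints) auto
    moreover have "w1 \<bullet> (x - p) = w1 \<bullet> (x - z0) - d"
      using p(2) by (simp add: inner_diff_right)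
    ultimately show ?thesis using that(2) by (metis Ints_nonzero_abs_ge1 eq_iff_diff_eq_0)
  qed
  have ex: ?thesis if "\<And>x. x \<in> ?S \<Longrightarrow> x \<noteq> p \<Longrightarrow>
     \<alpha> * (w1 \<bullet> (p - z0)) + \<beta> * (w2 \<bullet> (p - z0)) < \<alpha> * (w1 \<bullet> (x - z0)) + \<beta> * (w2 \<bullet> (x - z0))" for \<alpha> \<beta>
  proof -
    have "p extreme_point_of (convex hull ?S)"
    proof (rule unique_minimizer_extreme_point[OF pS, where g = "\<alpha> *\<^sub>R w1 + \<beta> *\<^sub>R w2"])
      fix x assume "x \<in> ?S" "x \<noteq> p"
      from that[OF this] show "(\<alpha> *\<^sub>R w1 + \<beta> *\<^sub>R w2) \<bullet> p < (\<alpha> *\<^sub>R w1 + \<beta> *\<^sub>R w2) \<bullet> x"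
        by (simp add: inner_diff_right inner_add_left algebra_simps)
    qed
    then show ?thesis using p(2) unfolding vert_def by blast
  qed
  show ?thesis
  proof (cases "d \<le> 1")
    case True
    \<comment> \<open>Points of \<open>?S\<close> off the line have \<open>X \<ge> d + 1\<close>,
      since no positive level precedes \<open>d\<close>. The value at \<open>p\<close> is
      \<open>f * (d + 1)\<close>; the others reach it by the \<open>X\<close> term and exceed it
      because \<open>Y > 0\<close>.\<close>
    show ?thesis
    proof (rule ex[of f 1])
      fix x assume x: "x \<in> ?S" "x \<noteq> p"
      show "f * (w1 \<bullet> (p - z0)) + 1 * (w2 \<bullet> (p - z0)) < f * (w1 \<bullet> (x - z0)) + 1 * (w2 \<bullet> (x - z0))"
      proof (cases "w1 \<bullet> (x - z0) = d")
        case True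
        then show ?thesis using low[of x] x S(2)[OF x(1)] p by auto
      next
        case False
        then have "d + 1 \<le> w1 \<bullet> (x - z0)" using gap[OF x(1)] S(1)[OF x(1)] \<open>d \<le> 1\<close> by auto
        then have "f * (d + 1) \<le> f * (w1 \<bullet> (x - z0))" using \<open>f > 0\<close> by simp
        then show ?thesis using S(3)[OF x(1)] p(2) by (simp add: distrib_left flip: f_def)
      qed
    qed
  next
    case False
    text \<open>The functional is constant on the chord of the curve \<open>y = m / x\<close> over
      \<open>[d - 1, d + 1]\<close>; at \<open>d\<close> this chord passes more than \<open>D\<close> above the curve, so the lowest
      lattice point on the line lies below it, while all other lattice lines meet the branch
      on or above it.\<close>
    have d1: "d\<^sup>2 - 1 > 0" using False by (simp add: power2_eq_square less_1_mult)
    have fp: "m * d + (d\<^sup>2 - 1) * f < 2 * d * m"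
    proof -
      \<comment> \<open>At \<open>d\<close> the chord is \<open>m / (d * (d\<^sup>2 - 1))\<close>
        above the curve, so the claim is that \<open>?D\<close> is smaller than this; the subtracted
        \<open>d * ?D\<close> makes it strict.\<close>
      have "d * (?D * (d\<^sup>2 - 1)) = d ^ 3 * ?D - d * ?D"
        by (simp add: power2_eq_square power3_eq_cube algebra_simps)
      also have "\<dots> < m" using d(2) d(1) det by (smt (verit) mult_pos_pos)
      finally have *: "?D * (d\<^sup>2 - 1) < m / d" using d(1) by (simp add: field_simps)
      have "(d\<^sup>2 - 1) * f < (d\<^sup>2 - 1) * (m / d + ?D)"
        using d1 p(4) f_def by simp
      also have "\<dots> = d * m - m / d + ?D * (d\<^sup>2 - 1)"
        using d(1) by (simp add: power2_eq_square field_simps)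
      finally show ?thesis using * by (simp add: algebra_simps)
    qed
    show ?thesis
    proof (rule ex[of m "d\<^sup>2 - 1"])
      fix x assume x: "x \<in> ?S" "x \<noteq> p"
      show "m * (w1 \<bullet> (p - z0)) + (d\<^sup>2 - 1) * (w2 \<bullet> (p - z0))
          < m * (w1 \<bullet> (x - z0)) + (d\<^sup>2 - 1) * (w2 \<bullet> (x - z0))"
      proof (cases "w1 \<bullet> (x - z0) = d")
        case True
        then show ?thesis using low[of x] x S(2)[OF x(1)] p d1 by auto
      next
        case False
        define e where "e = w1 \<bullet> (x - z0)"
        have "e > 0" using S(1)[OF x(1)] e_def by simp
        \<comment> \<open>Equivalently \<open>2 * d * e \<le> e\<^sup>2 + d\<^sup>2 - 1\<close>: at
          distance at least 1 from \<open>d\<close> the curve is on or above the line through the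
          chord.\<close>
        have "1 \<le> (e - d)\<^sup>2"
          using gap[OF x(1) False] unfolding e_def
          by (metis one_le_power power2_abs)
        then have "m * (2 * d * e) \<le> m * (e\<^sup>2 + (d\<^sup>2 - 1))"
          using \<open>m > 0\<close> by (intro mult_left_mono) (auto simp: power2_diff mult_ac)
        then have "2 * d * m \<le> m * e + (d\<^sup>2 - 1) * (m / e)"
          using \<open>e > 0\<close> by (simp add: field_simps power2_eq_square)
        also have "\<dots> \<le> m * e + (d\<^sup>2 - 1) * (w2 \<bullet> (x - z0))"
          using S(2)[OF x(1)] d1 unfolding e_def
          by (intro add_left_mono mult_left_mono) auto
        finally show ?thesis using fp unfolding e_def f_def p(2) by linarith
      qed
    qed
  qed
qed

section \<open>Convex components of the complement of the hyperbola\<close>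

text \<open>Multiplying the two coordinates of the convex combination leaves the cross term
  \<open>x1 * y2 + y1 * x2\<close>, which exceeds \<open>2 * m\<close> by the inequality of
  arithmetic and geometric means. The total then exceeds
  \<open>(u + v)\<^sup>2 * m = m\<close>.\<close>

lemma convex_open_branch:
  assumes "m > 0"
  shows "convex (open_branch w1 w2 z0 m)"
proof (rule convexI)
  fix x y :: "real \<times> real" and u v :: real
  assume xy: "x \<in> open_branch w1 w2 z0 m" "y \<in> open_branch w1 w2 z0 m"
    and uv: "0 \<le> u" "0 \<le> v" "u + v = 1"
  define x1 x2 y1 y2 where "x1 = w1 \<bullet> (x - z0)" and "x2 = w2 \<bullet> (x - z0)"
    and "y1 = w1 \<bullet> (y - z0)" and "y2 = w2 \<bullet> (y - z0)"
  note defs = x1_def x2_def y1_def y2_def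
  have pos: "x1 > 0" "y1 > 0" and mx: "m < x1 * x2" and my: "m < y1 * y2"
    using xy unfolding defs by (auto simp: open_branch_def)
  have shift: "u *\<^sub>R x + v *\<^sub>R y - z0 = u *\<^sub>R (x - z0) + v *\<^sub>R (y - z0)"
    using uv(3) by (simp add: scaleR_right_diff_distrib algebra_simps flip: scaleR_left_distrib)
  have L: "w1 \<bullet> (u *\<^sub>R x + v *\<^sub>R y - z0) = u * x1 + v * y1"
     "w2 \<bullet> (u *\<^sub>R x + v *\<^sub>R y - z0) = u * x2 + v * y2"
    unfolding shift defs by (simp_all add: inner_add_right)
  have first: "0 < u * x1 + v * y1"
    using pos uv by (smt (verit) mult_pos_pos mult_nonneg_nonneg)
  have cross: "2 * m < x1 * y2 + y1 * x2"
  proof -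
    have "x2 > m / x1" "y2 > m / y1" using mx my pos by (simp_all add: field_simps)
    then have "x1 * (m / y1) + y1 * (m / x1) < x1 * y2 + y1 * x2"
      using pos by (intro add_strict_mono mult_strict_left_mono) auto
    moreover have "2 * m \<le> x1 * (m / y1) + y1 * (m / x1)"
    proof -
      have "0 \<le> m * (x1 - y1)\<^sup>2" using assms by simp
      then show ?thesis using pos by (simp add: field_simps power2_eq_square)
    qed
    ultimately show ?thesis by linarith
  qed
  have "m < (u * x1 + v * y1) * (u * x2 + v * y2)"
  proof -
    have "m = u\<^sup>2 * m + v\<^sup>2 * m + (u * v) * (2 * m)"
    proof -
      have "u\<^sup>2 * m + v\<^sup>2 * m + (u * v) * (2 * m) = (u + v)\<^sup>2 * m"
        by (simp add: power2_eq_square algebra_simps)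
      then show ?thesis using uv(3) by simp
    qed
    \<comment> \<open>Strictness comes from the square term of a nonzero weight; for
      \<open>u = 0\<close> this is the term of \<open>v\<close>.\<close>
    also have "\<dots> < u\<^sup>2 * (x1 * x2) + v\<^sup>2 * (y1 * y2) + (u * v) * (x1 * y2 + y1 * x2)"
    proof (cases "u = 0")
      case True
      then show ?thesis using uv(3) my by simp
    next
      case False
      then have "u\<^sup>2 * m < u\<^sup>2 * (x1 * x2)" using mx by simp
      moreover have "v\<^sup>2 * m \<le> v\<^sup>2 * (y1 * y2)"
        using my by (intro mult_left_mono) auto
      moreover have "(u * v) * (2 * m) \<le> (u * v) * (x1 * y2 + y1 * x2)"
        using cross uv by (intro mult_left_mono) auto
      ultimately show ?thesis by linarith
    qed
    also have "\<dots> = (u * x1 + v * y1) * (u * x2 + v * y2)"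
      by (simp add: power2_eq_square algebra_simps)
    finally show ?thesis .
  qed
  with first show "u *\<^sub>R x + v *\<^sub>R y \<in> open_branch w1 w2 z0 m"
    unfolding open_branch_def by (simp add: L)
qed

lemma open_open_branch: "open (open_branch w1 w2 z0 m)"
  unfolding open_branch_def
  by (intro open_Collect_conj open_Collect_less continuous_intros)

text \<open>Relaxing both inequalities gives a closed set, and \<open>m > 0\<close> excludes the
  level 0 from it. Conversely, dilating from \<open>z0\<close> by a factor slightly above 1
  increases the product of the coordinates and so approximates a boundary point from the open
  branch.\<close>

lemma closure_open_branch:
  assumes "m > 0"
  shows "closure (open_branch w1 w2 z0 m) = branch w1 w2 z0 m"
proof
  let ?K = "{z. 0 \<le> w1 \<bullet> (z - z0) \<and> m \<le> (w1 \<bullet> (z - z0)) * (w2 \<bullet> (z - z0))}"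
  have "closed ?K"
    by (intro closed_Collect_conj closed_Collect_le continuous_intros)
  moreover have "open_branch w1 w2 z0 m \<subseteq> ?K" by (auto simp: open_branch_def)
  moreover have "?K \<subseteq> branch w1 w2 z0 m"
    using assms by (auto simp: branch_def less_le)
  ultimately show "closure (open_branch w1 w2 z0 m) \<subseteq> branch w1 w2 z0 m"
    using closure_minimal[of "open_branch w1 w2 z0 m" ?K] by blast
next
  show "branch w1 w2 z0 m \<subseteq> closure (open_branch w1 w2 z0 m)"
  proof
    fix z assume z: "z \<in> branch w1 w2 z0 m"
    define f where "f = (\<lambda>i. z0 + (1 + inverse (real (Suc i))) *\<^sub>R (z - z0))"
    have "f \<longlonglongrightarrow> z0 + (1 + 0) *\<^sub>R (z - z0)"
      unfolding f_def by (intro tendsto_intros LIMSEQ_inverse_real_of_nat)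
    then have lim: "f \<longlonglongrightarrow> z" by simp
    have "f i \<in> open_branch w1 w2 z0 m" for i
    proof -
      define t where "t = 1 + inverse (real (Suc i))"
      have "t > 1" by (simp add: t_def)
      have f: "f i - z0 = t *\<^sub>R (z - z0)" by (simp add: f_def t_def)
      let ?P = "(w1 \<bullet> (z - z0)) * (w2 \<bullet> (z - z0))"
      have "m \<le> ?P" "0 < w1 \<bullet> (z - z0)" using z by (auto simp: branch_def)
      moreover have "1 * ?P < (t * t) * ?P"
        using \<open>t > 1\<close> \<open>m \<le> ?P\<close> assms by (intro mult_strict_right_mono less_1_mult) auto
      ultimately have "m < (t * (w1 \<bullet> (z - z0))) * (t * (w2 \<bullet> (z - z0)))"
        by (simp only: mult_ac mult_1)
      then show ?thesis
        using \<open>t > 1\<close> \<open>0 < w1 \<bullet> (z - z0)\<close> by (simp add: open_branch_def f)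
    qed
    then show "z \<in> closure (open_branch w1 w2 z0 m)"
      using lim unfolding closure_sequential by blast
  qed
qed

lemma det2_solve:
  assumes "det2 w1 w2 \<noteq> 0"
  obtains z where "w1 \<bullet> (z - z0) = s" "w2 \<bullet> (z - z0) = t"
proof -
  define y where "y = ((s * snd w2 - t * snd w1) / det2 w1 w2, (t * fst w1 - s * fst w2) / det2 w1 w2)"
  have "w1 \<bullet> y = (fst w1 * (s * snd w2 - t * snd w1) + snd w1 * (t * fst w1 - s * fst w2)) / det2 w1 w2"
    "w2 \<bullet> y = (fst w2 * (s * snd w2 - t * snd w1) + snd w2 * (t * fst w1 - s * fst w2)) / det2 w1 w2"
    by (simp_all add: y_def inner_prod_def add_divide_distrib)
  moreover have "fst w1 * (s * snd w2 - t * snd w1) + snd w1 * (t * fst w1 - s * fst w2) = s * det2 w1 w2"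
    "fst w2 * (s * snd w2 - t * snd w1) + snd w2 * (t * fst w1 - s * fst w2) = t * det2 w1 w2"
    by (simp_all add: det2_def algebra_simps)
  ultimately show ?thesis using assms by (intro that[of "z0 + y"]) auto
qed

text \<open>The complement of \<open>h\<close> consists of the two open branches and the open region
  \<open>?M\<close> between them. The latter is star-shaped about \<open>z0\<close>, so a component
  missing both branches would be all of \<open>?M\<close>, which is not convex.\<close>

lemma convex_component_hyperbola:
  assumes m: "m > 0" and det: "det2 w1 w2 \<noteq> 0"
    and h: "h = {z. (w1 \<bullet> (z - z0)) * (w2 \<bullet> (z - z0)) = m}"
    and C: "C \<in> components (UNIV - h)" "convex C"
  shows "C = open_branch w1 w2 z0 m \<or> C = open_branch (- w1) (- w2) z0 m"
proof -
  let ?R = "open_branch w1 w2 z0 m" and ?R' = "open_branch (- w1) (- w2) z0 m"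
  let ?M = "{z. (w1 \<bullet> (z - z0)) * (w2 \<bullet> (z - z0)) < m}"
  have C0: "C \<noteq> {}" "connected C" "C \<subseteq> UNIV - h"
    using C(1) in_components_nonempty in_components_connected in_components_subset by blast+
  have open_M: "open ?M" by (intro open_Collect_less continuous_intros)
  have cover: "UNIV - h \<subseteq> ?R \<union> (?R' \<union> ?M)"
  proof
    fix z assume "z \<in> UNIV - h"
    then have "(w1 \<bullet> (z - z0)) * (w2 \<bullet> (z - z0)) \<noteq> m" by (simp add: h)
    then show "z \<in> ?R \<union> (?R' \<union> ?M)"
      using m by (cases "w1 \<bullet> (z - z0)" "0::real" rule: linorder_cases) (auto simp: open_branch_def)
  qed
  have R_sub: "?R \<subseteq> UNIV - h" "?R' \<subseteq> UNIV - h" "?M \<subseteq> UNIV - h"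
    by (auto simp: open_branch_def h)
  have "C \<inter> ?R \<noteq> {} \<or> C \<inter> ?R' \<noteq> {}"
  proof (rule ccontr)
    assume "\<not> ?thesis"
    then have CM: "C \<subseteq> ?M" using C0(3) cover by blast
    have "connected ?M"
    proof (rule starlike_imp_connected, unfold starlike_def, intro bexI ballI)
      show "z0 \<in> ?M" using m by simp
      fix x assume x: "x \<in> ?M"
      show "closed_segment z0 x \<subseteq> ?M"
      proof
        fix y assume "y \<in> closed_segment z0 x"
        then obtain u where u: "0 \<le> u" "u \<le> 1" "y = (1 - u) *\<^sub>R z0 + u *\<^sub>R x"
          by (auto simp: in_segment)
        have y: "y - z0 = u *\<^sub>R (x - z0)" unfolding u(3) by (simp add: algebra_simps)
        let ?P = "(w1 \<bullet> (x - z0)) * (w2 \<bullet> (x - z0))"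
        have "u * u \<le> 1" using u mult_le_one by blast
        have "(u * u) * ?P < m"
        proof (cases "?P \<le> 0")
          case True
          then have "(u * u) * ?P \<le> 0" by (simp add: mult_nonneg_nonpos)
          then show ?thesis using m by linarith
        next
          case False
          then have "(u * u) * ?P \<le> 1 * ?P" using \<open>u * u \<le> 1\<close> by (intro mult_right_mono) auto
          then show ?thesis using x by simp
        qed
        then show "y \<in> ?M" by (simp add: y mult_ac)
      qed
    qed
    moreover have "C \<inter> ?M \<noteq> {}" using CM C0(1) by blast
    ultimately have "?M \<subseteq> C" using components_maximal[OF C(1)] R_sub(3) by blast
    \<comment> \<open>Two points on the asymptotes whose midpoint has both coordinates
      \<open>m + 1\<close>, with product above \<open>m\<close>.\<close>
    obtain x where x: "w1 \<bullet> (x - z0) = 2 * m + 2" "w2 \<bullet> (x - z0) = 0"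
      using det2_solve[OF det] .
    obtain y where y: "w1 \<bullet> (y - z0) = 0" "w2 \<bullet> (y - z0) = 2 * m + 2"
      using det2_solve[OF det] .
    have "x \<in> ?M" "y \<in> ?M" using x y m by auto
    then have "x \<in> C" "y \<in> C" using \<open>?M \<subseteq> C\<close> by auto
    then have "(1/2) *\<^sub>R x + (1/2) *\<^sub>R y \<in> C"
      using C(2) by (intro convexD) auto
    then have mid: "(1/2) *\<^sub>R x + (1/2) *\<^sub>R y \<in> ?M" using CM by blast
    have "(1/2) *\<^sub>R x + (1/2) *\<^sub>R y - z0 = (1/2) *\<^sub>R (x - z0) + (1/2) *\<^sub>R (y - z0)"
      by (simp add: algebra_simps flip: scaleR_left_distrib)
    then have "w1 \<bullet> ((1/2) *\<^sub>R x + (1/2) *\<^sub>R y - z0) = m + 1"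
        "w2 \<bullet> ((1/2) *\<^sub>R x + (1/2) *\<^sub>R y - z0) = m + 1"
      using x y by (simp_all add: inner_add_right)
    then have "(m + 1) * (m + 1) < m" using mid by simp
    moreover have "(m + 1) * (m + 1) = m * m + 2 * m + 1" by (simp add: algebra_simps)
    ultimately show False using m mult_pos_pos[OF m m] by linarith
  qed
  \<comment> \<open>Maximality of the component gives one inclusion; connectedness of
    \<open>C\<close> against the separation by \<open>T\<close> and \<open>U\<close> gives the
    other.\<close>
  moreover have "C = T"
    if "C \<inter> T \<noteq> {}" "convex T" "open T" "open U" "T \<inter> U = {}" "C \<subseteq> T \<union> U" "T \<subseteq> UNIV - h" for T U
  proof
    show "T \<subseteq> C" using components_maximal[OF C(1)] that convex_connected by blast
    show "C \<subseteq> T" using connectedD[OF C0(2), of T U] that by blast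
  qed
  moreover have "?R \<inter> (?R' \<union> ?M) = {}" "?R' \<inter> (?R \<union> ?M) = {}"
    by (auto simp: open_branch_def)
  moreover have "C \<subseteq> ?R \<union> (?R' \<union> ?M)" "C \<subseteq> ?R' \<union> (?R \<union> ?M)"
    using C0(3) cover by blast+
  ultimately show ?thesis
    using R_sub open_M open_open_branch convex_open_branch[OF m]
    by (metis (no_types, lifting) open_Un)
qed

section \<open>Asymptotes of the hyperbola\<close>

lemma eventually_abs_affine_ge:
  fixes \<alpha> \<gamma> K :: real
  assumes "\<alpha> \<noteq> 0"
  shows "eventually (\<lambda>t. K \<le> \<bar>\<gamma> + t * \<alpha>\<bar>) at_top"
  using eventually_ge_at_top[of "(K + \<bar>\<gamma>\<bar>) / \<bar>\<alpha>\<bar>"] eventually_ge_at_top[of 0]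
proof eventually_elim
  case (elim t)
  then have "K + \<bar>\<gamma>\<bar> \<le> t * \<bar>\<alpha>\<bar>" using assms by (simp add: field_simps)
  also have "\<dots> = \<bar>t * \<alpha>\<bar>" using elim by (simp add: abs_mult)
  finally show ?case by linarith
qed

text \<open>Along the line \<open>w2\<close> becomes unbounded. If \<open>w1\<close> did not vanish
  on the whole line, it would stay away from 0 far out, and nearby points of \<open>h\<close> would
  have too large a product of coordinates.\<close>

lemma asymptote_direction:
  assumes ne: "h \<noteq> {}" and h: "h \<subseteq> {z. (w1 \<bullet> (z - z0)) * (w2 \<bullet> (z - z0)) = m}"
    and lim: "((\<lambda>p. infdist p h) \<longlongrightarrow> 0) (inf at_infinity (principal A))"
    and A: "\<And>t. p + t *\<^sub>R v \<in> A" and w2v: "w2 \<bullet> v \<noteq> 0"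
  shows "w1 \<bullet> v = 0 \<and> w1 \<bullet> (p - z0) = 0"
proof (rule ccontr)
  assume neg: "\<not> ?thesis"
  let ?\<gamma> = "\<lambda>t. p + t *\<^sub>R v"
  have line: "w \<bullet> (?\<gamma> t - z0) = w \<bullet> (p - z0) + t * (w \<bullet> v)" for w t
    by (simp add: inner_diff_right inner_add_right)
  have "v \<noteq> 0" using w2v by auto
  have "\<exists>c>0. eventually (\<lambda>t. c \<le> \<bar>w1 \<bullet> (?\<gamma> t - z0)\<bar>) at_top"
  proof (cases "w1 \<bullet> v = 0")
    case True
    then show ?thesis using neg
      by (intro exI[of _ "\<bar>w1 \<bullet> (p - z0)\<bar>"]) (auto simp: line)
  next
    case False
    then show ?thesis
      unfolding line using eventually_abs_affine_ge by (intro exI[of _ 1]) auto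
  qed
  then obtain c where c: "c > 0" "eventually (\<lambda>t. c \<le> \<bar>w1 \<bullet> (?\<gamma> t - z0)\<bar>) at_top" by blast
  \<comment> \<open>Moving by \<delta> changes the value of \<open>w1\<close> by at most
    \<open>c / 2\<close>; the \<open>+ 1\<close> covers \<open>w1 = 0\<close>. With \<open>K\<close>
    below, a point of \<open>h\<close> within \<delta> has a product of absolute value at least
    \<open>\<bar>m\<bar> + 1\<close>.\<close>
  define \<delta> where "\<delta> = c / (2 * (norm w1 + 1))"
  have \<delta>: "\<delta> > 0" using c(1) by (simp add: \<delta>_def add_nonneg_pos)
  have w1\<delta>: "norm w1 * \<delta> \<le> c / 2"
  proof -
    have "norm w1 / (norm w1 + 1) \<le> 1" by (simp add: divide_le_eq add_nonneg_pos)
    then have "c / 2 * (norm w1 / (norm w1 + 1)) \<le> c / 2 * 1"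
      using c(1) by (intro mult_left_mono) auto
    then show ?thesis by (simp add: \<delta>_def mult.commute)
  qed
  define K where "K = norm w2 * \<delta> + 2 * (\<bar>m\<bar> + 1) / c"
  have "eventually (\<lambda>p. infdist p h < \<delta>) (inf at_infinity (principal A))"
    using order_tendstoD(2)[OF lim \<delta>] .
  then obtain b where b: "\<And>z. norm z \<ge> b \<Longrightarrow> z \<in> A \<Longrightarrow> infdist z h < \<delta>"
    by (auto simp: eventually_inf_principal eventually_at_infinity)
  \<comment> \<open>The triangle inequality reduces this to \<open>t * norm v - norm p\<close>; the
    second event makes that difference nonnegative.\<close>
  have "eventually (\<lambda>t. b \<le> norm (?\<gamma> t)) at_top"
    using eventually_abs_affine_ge[of "norm v" b "- norm p", simplified, OF \<open>v \<noteq> 0\<close>]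
      eventually_ge_at_top[of "norm p / norm v"]
  proof eventually_elim
    case (elim t)
    then have "norm p \<le> t * norm v" using \<open>v \<noteq> 0\<close> by (simp add: field_simps)
    moreover have "t \<ge> 0" using elim(2) by (smt (verit) divide_nonneg_nonneg norm_ge_zero)
    moreover have "norm (t *\<^sub>R v) \<le> norm (?\<gamma> t) + norm p"
      by (metis add_diff_cancel_left' norm_triangle_ineq4)
    ultimately show ?case using elim(1) \<open>v \<noteq> 0\<close> by simp
  qed
  moreover have "eventually (\<lambda>t. K \<le> \<bar>w2 \<bullet> (?\<gamma> t - z0)\<bar>) at_top"
    unfolding line using w2v by (rule eventually_abs_affine_ge)
  ultimately have "eventually (\<lambda>t. b \<le> norm (?\<gamma> t) \<and> K \<le> \<bar>w2 \<bullet> (?\<gamma> t - z0)\<bar> \<and>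
      c \<le> \<bar>w1 \<bullet> (?\<gamma> t - z0)\<bar>) at_top"
    using c(2) by eventually_elim auto
  then obtain t where t: "b \<le> norm (?\<gamma> t)" "K \<le> \<bar>w2 \<bullet> (?\<gamma> t - z0)\<bar>" "c \<le> \<bar>w1 \<bullet> (?\<gamma> t - z0)\<bar>"
    using eventually_happens'[OF trivial_limit_at_top_linorder] by blast
  have "infdist (?\<gamma> t) h < \<delta>" using b t A by blast
  then obtain q where q: "q \<in> h" "dist (?\<gamma> t) q < \<delta>"
    using ne le_setdist_iff[of \<delta> "{?\<gamma> t}" h] by (auto simp: infdist_eq_setdist not_le)
  have near: "\<bar>w \<bullet> (?\<gamma> t - z0)\<bar> - norm w * \<delta> \<le> \<bar>w \<bullet> (q - z0)\<bar>" for w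
  proof -
    have "\<bar>w \<bullet> (?\<gamma> t - q)\<bar> \<le> norm w * norm (?\<gamma> t - q)" by (rule Cauchy_Schwarz_ineq2)
    also have "\<dots> \<le> norm w * \<delta>" using q(2) by (intro mult_left_mono) (auto simp: dist_norm)
    finally show ?thesis by (simp add: inner_diff_right)
  qed
  have "c / 2 \<le> \<bar>w1 \<bullet> (q - z0)\<bar>" using near[of w1] t(3) w1\<delta> by linarith
  moreover have "2 * (\<bar>m\<bar> + 1) / c \<le> \<bar>w2 \<bullet> (q - z0)\<bar>" using near[of w2] t(2) K_def by linarith
  ultimately have "(c / 2) * (2 * (\<bar>m\<bar> + 1) / c) \<le> \<bar>w1 \<bullet> (q - z0)\<bar> * \<bar>w2 \<bullet> (q - z0)\<bar>"
    using c(1) by (intro mult_mono) auto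
  moreover have "\<bar>w1 \<bullet> (q - z0)\<bar> * \<bar>w2 \<bullet> (q - z0)\<bar> = \<bar>m\<bar>"
    using h q(1) by (auto simp flip: abs_mult)
  ultimately show False using c(1) by simp
qed

text \<open>By independence of \<open>w1\<close> and \<open>w2\<close>, one of them is not constant
  along \<open>A\<close>; then the other vanishes on \<open>A\<close>. Equality with its zero line
  follows by comparing dimensions.\<close>

lemma asymptote_of_hyperbola:
  assumes det: "det2 w1 w2 \<noteq> 0"
    and h: "h = {z. (w1 \<bullet> (z - z0)) * (w2 \<bullet> (z - z0)) = m}"
    and A: "A asymptote_of h"
  shows "A = {z. w1 \<bullet> (z - z0) = 0} \<or> A = {z. w2 \<bullet> (z - z0) = 0}"
proof -
  have aff: "affine A" "aff_dim A = 1"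
    and lim: "((\<lambda>p. infdist p h) \<longlongrightarrow> 0) (inf at_infinity (principal A))"
    using A by (auto simp: asymptote_of_def)
  obtain z where "w1 \<bullet> (z - z0) = 1" "w2 \<bullet> (z - z0) = m"
    using det2_solve[OF det] .
  then have "z \<in> h" by (simp add: h)
  then have h_ne: "h \<noteq> {}" by blast
  obtain p where p: "p \<in> A" using aff(2) aff_dim_empty by (metis ex_in_conv one_neq_neg_one)
  have "A \<noteq> {p}" using aff(2) by auto
  then obtain p' where p': "p' \<in> A" "p' \<noteq> p" using p by blast
  define v where "v = p' - p"
  have v0: "v \<noteq> 0" using p' by (simp add: v_def)
  have line: "p + t *\<^sub>R v \<in> A" for t
  proof -
    have "(1 - t) *\<^sub>R p + t *\<^sub>R p' \<in> A" using aff(1) p p' by (intro mem_affine) auto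
    then show ?thesis by (simp add: v_def algebra_simps)
  qed
  have A_eq: "A = {p + t *\<^sub>R v |t. t \<in> UNIV}"
  proof -
    have "affine hull {p, p'} \<subseteq> A" using aff(1) p p' by (simp add: hull_minimal)
    moreover have "aff_dim (affine hull {p, p'}) = 1" using p'(2) by (simp add: aff_dim_2)
    ultimately have "affine hull {p, p'} = A"
      using aff by (intro affine_dim_equal) auto
    then show ?thesis by (auto simp: affine_hull_2_alt v_def)
  qed
  have main: "A = {z. w \<bullet> (z - z0) = 0}"
    if "w \<bullet> v = 0" "w \<bullet> (p - z0) = 0" "w \<noteq> 0" for w
  proof (rule affine_dim_equal)
    show "A \<subseteq> {z. w \<bullet> (z - z0) = 0}"
      unfolding A_eq using that by (auto simp: inner_diff_right inner_add_right)
    have eq: "{z. w \<bullet> (z - z0) = 0} = {z. w \<bullet> z = w \<bullet> z0}"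
      by (simp add: inner_diff_right)
    show "affine {z. w \<bullet> (z - z0) = 0}" unfolding eq by (rule affine_hyperplane)
    show "aff_dim A = aff_dim {z. w \<bullet> (z - z0) = 0}"
      unfolding eq using that(3) aff(2) by (simp add: aff_dim_hyperplane)
  qed (use aff p in auto)
  have w0: "w1 \<noteq> 0" "w2 \<noteq> 0" using det by (auto simp: det2_def)
  have "w1 \<bullet> v \<noteq> 0 \<or> w2 \<bullet> v \<noteq> 0"
  proof (rule ccontr)
    assume "\<not> ?thesis"
    then have *: "fst w1 * fst v + snd w1 * snd v = 0" "fst w2 * fst v + snd w2 * snd v = 0"
      by (auto simp: inner_prod_def)
    have "det2 w1 w2 * fst v = snd w2 * (fst w1 * fst v + snd w1 * snd v)
        - snd w1 * (fst w2 * fst v + snd w2 * snd v)"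
      "det2 w1 w2 * snd v = fst w1 * (fst w2 * fst v + snd w2 * snd v)
        - fst w2 * (fst w1 * fst v + snd w1 * snd v)"
      by (simp_all add: det2_def algebra_simps)
    then show False using * det v0 by (auto simp: prod_eq_iff)
  qed
  then show ?thesis
  proof
    assume "w2 \<bullet> v \<noteq> 0"
    then have "w1 \<bullet> v = 0 \<and> w1 \<bullet> (p - z0) = 0"
      using h by (intro asymptote_direction[OF h_ne _ lim line, where m = m]) auto
    then show ?thesis using main w0 by blast
  next
    assume "w1 \<bullet> v \<noteq> 0"
    then have "w2 \<bullet> v = 0 \<and> w2 \<bullet> (p - z0) = 0"
      using h by (intro asymptote_direction[OF h_ne _ lim line, where m = m]) (auto simp: mult.commute)
    then show ?thesis using main w0 by blast
  qed
qed

section \<open>Lattice lines parallel to an asymptote\<close>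

text \<open>Cauchy-Schwarz gives the lower bound, and the perpendicular from \<open>z0\<close>
  attains it. Ordering lattice lines by distance thus amounts to ordering them by level.\<close>

lemma setdist_parallel_hyperplanes:
  fixes w z0 :: "'a::euclidean_space"
  assumes "w \<noteq> 0" "d \<ge> 0"
  shows "setdist {z. w \<bullet> (z - z0) = 0} {z. w \<bullet> (z - z0) = d} = d / norm w"
proof (rule antisym)
  let ?y = "z0 + (d / (norm w)\<^sup>2) *\<^sub>R w"
  have y: "w \<bullet> (?y - z0) = d" using assms(1) by (simp add: dot_square_norm)
  have "setdist {z. w \<bullet> (z - z0) = 0} {z. w \<bullet> (z - z0) = d} \<le> dist z0 ?y"
    using y by (intro setdist_le_dist) auto
  also have "\<dots> = d / norm w"
    using assms by (simp add: dist_norm power2_eq_square)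
  finally show "setdist {z. w \<bullet> (z - z0) = 0} {z. w \<bullet> (z - z0) = d} \<le> d / norm w" .
  show "d / norm w \<le> setdist {z. w \<bullet> (z - z0) = 0} {z. w \<bullet> (z - z0) = d}"
  proof (rule le_setdistI)
    have "z0 \<in> {z. w \<bullet> (z - z0) = 0}" by simp
    then show "{z. w \<bullet> (z - z0) = 0} \<noteq> {}" by blast
    have "?y \<in> {z. w \<bullet> (z - z0) = d}" using y by simp
    then show "{z. w \<bullet> (z - z0) = d} \<noteq> {}" by blast
    fix x z assume "x \<in> {z. w \<bullet> (z - z0) = 0}" "z \<in> {z. w \<bullet> (z - z0) = d}"
    then have "d = w \<bullet> (z - x)" by (simp add: inner_diff_right)
    also have "\<dots> \<le> norm w * norm (z - x)" by (rule norm_cauchy_schwarz)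
    finally show "d / norm w \<le> dist x z"
      using assms(1) by (simp add: dist_norm norm_minus_commute divide_le_eq mult.commute)
  qed
qed

text \<open>Strict monotonicity excludes ties, so the index set of a closest family is downward
  closed, and its size determines it. Uniqueness settles the existential and the universal claim
  about closest lines together.\<close>

lemma closest_members_range:
  fixes f :: "nat \<Rightarrow> (real \<times> real) set"
  assumes mono: "strict_mono (\<lambda>i. setdist A (f i))"
  shows "closest_members k A (range f) S \<longleftrightarrow> S = f ` {..<k}"
proof
  have inj: "inj f"
    using strict_mono_eq[OF mono] by (metis injI)
  have le: "setdist A (f i) \<le> setdist A (f j) \<longleftrightarrow> i \<le> j" for i j
    using strict_mono_less_eq[OF mono] .
  show "S = f ` {..<k}" if S: "closest_members k A (range f) S"
  proof -
    define I where "I = f -` S"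
    have SI: "S = f ` I" using S by (auto simp: closest_members_def I_def)
    have "finite S" "card S = k" using S by (auto simp: closest_members_def)
    moreover have "card S = card I" unfolding SI by (intro card_image inj_on_subset[OF inj]) simp
    ultimately have I: "finite I" "card I = k"
      using finite_vimageI[OF _ inj] by (auto simp: I_def)
    have "I \<subseteq> {..<k}"
    proof
      fix i assume i: "i \<in> I"
      have "j \<in> I" if "j \<le> i" for j
      proof (rule ccontr)
        assume "j \<notin> I"
        then have "f j \<in> range f - S" "f i \<in> S" using i by (auto simp: I_def)
        then have "setdist A (f i) \<le> setdist A (f j)" using S unfolding closest_members_def by blast
        then have "i \<le> j" by (simp only: le)
        then show False using that \<open>j \<notin> I\<close> i by auto
      qed
      then have "card {..i} \<le> card I" using I(1) by (intro card_mono) auto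
      then show "i \<in> {..<k}" using I(2) by simp
    qed
    then have "I = {..<k}" using I(2) by (intro card_subset_eq) auto
    then show ?thesis using SI by simp
  qed
  show "closest_members k A (range f) S" if "S = f ` {..<k}"
    unfolding closest_members_def that
    using inj le by (auto simp: card_image inj_on_subset)
qed

text \<open>For primitive \<open>w\<close> this is the least positive value of
  \<open>w \<bullet> (z - z0)\<close> at lattice points \<open>z\<close>. Floor plus one, rather
  than the ceiling, skips the asymptote itself when it contains lattice points.\<close>

definition first_level :: "real \<times> real \<Rightarrow> real \<times> real \<Rightarrow> real" where
  "first_level w z0 = real_of_int \<lfloor>w \<bullet> z0\<rfloor> + 1 - w \<bullet> z0"

lemma first_level_bounds: "0 < first_level w z0" "first_level w z0 \<le> 1"
  unfolding first_level_def by linarith+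

lemma positive_lattice_level:
  assumes "w \<in> \<int> \<times> \<int>" "z \<in> \<int> \<times> \<int>" "0 < w \<bullet> (z - z0)"
  obtains i :: nat where "w \<bullet> (z - z0) = first_level w z0 + real i"
proof -
  obtain j :: int where j: "w \<bullet> z = real_of_int j"
    using inner_lattice_Ints[OF assms(1,2)] by (auto elim: Ints_cases)
  then have "\<lfloor>w \<bullet> z0\<rfloor> < j" using assms(3) by (simp add: inner_diff_right) linarith
  then show ?thesis
    using j by (intro that[of "nat (j - \<lfloor>w \<bullet> z0\<rfloor> - 1)"]) (simp add: first_level_def inner_diff_right)
qed

lemma lattice_point_on_level:
  assumes "primitive w"
  obtains z where "z \<in> \<int> \<times> \<int>" "w \<bullet> (z - z0) = first_level w z0 + real i"
proof -
  obtain z where "z \<in> \<int> \<times> \<int>" "w \<bullet> z = real_of_int \<lfloor>w \<bullet> z0\<rfloor> + 1 + real i"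
    using primitive_inner_surj[OF assms, of "real_of_int \<lfloor>w \<bullet> z0\<rfloor> + 1 + real i"] by auto
  then show ?thesis by (intro that[of z]) (auto simp: first_level_def inner_diff_right)
qed

text \<open>Translates of the asymptote are level lines of \<open>w1\<close>. Meeting the branch
  forces a positive level, and containing a lattice point restricts it to the listed ones;
  conversely the curve \<open>Y = m / X\<close> meets every positive level.\<close>

lemma lattice_lines_branch:
  assumes w1: "primitive w1" and det: "det2 w1 w2 \<noteq> 0" and m: "m > 0"
  shows "lattice_lines {z. w1 \<bullet> (z - z0) = 0} (branch w1 w2 z0 m) =
    range (\<lambda>i. {z. w1 \<bullet> (z - z0) = first_level w1 z0 + real i})"
proof (intro set_eqI iffI)
  let ?A = "{z. w1 \<bullet> (z - z0) = 0}" and ?H = "branch w1 w2 z0 m"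
  have translate: "(+) v ` ?A = {z. w1 \<bullet> (z - z0) = w1 \<bullet> v}" for v
  proof -
    have "z \<in> (+) v ` ?A" if "w1 \<bullet> (z - z0) = w1 \<bullet> v" for z
      using that by (intro image_eqI[of _ _ "z - v"]) (auto simp: inner_diff_right)
    then show ?thesis by (auto simp: inner_diff_right inner_add_right)
  qed
  fix L
  show "L \<in> range (\<lambda>i. {z. w1 \<bullet> (z - z0) = first_level w1 z0 + real i})"
    if L_in: "L \<in> lattice_lines ?A ?H"
  proof -
    obtain v where "L = (+) v ` ?A"
      using L_in unfolding lattice_lines_def affine_parallel_def by blast
    then have L: "L = {z. w1 \<bullet> (z - z0) = w1 \<bullet> v}" by (simp only: translate)
    obtain z y where z: "z \<in> L" "z \<in> \<int> \<times> \<int>" and y: "y \<in> L" "y \<in> ?H"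
      using L_in unfolding lattice_lines_def by blast
    have "0 < w1 \<bullet> v" using y L by (auto simp: branch_def)
    then have "0 < w1 \<bullet> (z - z0)" using z L by auto
    then obtain i where "w1 \<bullet> (z - z0) = first_level w1 z0 + real i"
      using positive_lattice_level primitive_imp_lattice[OF w1] z(2) by metis
    then have "L = {z. w1 \<bullet> (z - z0) = first_level w1 z0 + real i}" using z(1) L by auto
    then show ?thesis by blast
  qed
  show "L \<in> lattice_lines ?A ?H"
    if L_in: "L \<in> range (\<lambda>i. {z. w1 \<bullet> (z - z0) = first_level w1 z0 + real i})"
  proof -
    obtain i where L: "L = {z. w1 \<bullet> (z - z0) = first_level w1 z0 + real i}" using L_in by blast
    let ?d = "first_level w1 z0 + real i"
    have d: "?d > 0" using first_level_bounds(1)[of w1 z0] by linarith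
    obtain y where y: "w1 \<bullet> (y - z0) = ?d" "w2 \<bullet> (y - z0) = m / ?d"
      using det2_solve[OF det] .
    have "affine_parallel ?A L"
      unfolding affine_parallel_def using translate[of "y - z0"] y(1) L by metis
    moreover obtain z where "z \<in> \<int> \<times> \<int>" "w1 \<bullet> (z - z0) = ?d"
      using lattice_point_on_level[OF w1] .
    then have "z \<in> L \<inter> \<int> \<times> \<int>" using L by simp
    moreover have "y \<in> L \<inter> ?H" using y d L by (simp add: branch_def)
    ultimately show ?thesis unfolding lattice_lines_def by blast
  qed
qed

lemma level_contains_vertex:
  assumes "primitive w1" "det2 w1 w2 \<noteq> 0" "m > 0"
    and N: "real N ^ 3 * \<bar>det2 w1 w2\<bar> \<le> m" and "i < N"
  shows "\<exists>p. p \<in> vert (convex hull (branch w1 w2 z0 m \<inter> \<int> \<times> \<int>)) \<and>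
    w1 \<bullet> (p - z0) = first_level w1 z0 + real i"
proof -
  let ?d = "first_level w1 z0 + real i"
  \<comment> \<open>Counting from \<open>i = 0\<close> and \<open>first_level \<le> 1\<close> give
    \<open>?d \<le> i + 1 \<le> N\<close>.\<close>
  have d: "?d > 0" "?d \<le> real N" using first_level_bounds[of w1 z0] \<open>i < N\<close> by linarith+
  obtain z where z: "z \<in> \<int> \<times> \<int>" "w1 \<bullet> (z - z0) = ?d"
    using lattice_point_on_level[OF assms(1)] .
  have "?d ^ 3 * \<bar>det2 w1 w2\<bar> \<le> real N ^ 3 * \<bar>det2 w1 w2\<bar>"
    using d by (intro mult_right_mono power_mono) auto
  with N have "?d ^ 3 * \<bar>det2 w1 w2\<bar> \<le> m" by linarith
  then show ?thesis by (rule lattice_line_contains_vertex[OF assms(1-3) d(1) _ z])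
qed

lemma closest_lattice_lines_contain_vertices:
  assumes "primitive w1" "det2 w1 w2 \<noteq> 0" "m > 0"
    and N: "real N ^ 3 * \<bar>det2 w1 w2\<bar> \<le> m"
    and A: "A = {z. w1 \<bullet> (z - z0) = 0}" and H: "H = branch w1 w2 z0 m"
  shows "(\<exists>S. closest_members N A (lattice_lines A H) S) \<and>
    (\<forall>S. closest_members N A (lattice_lines A H) S \<longrightarrow>
      (\<forall>L\<in>S. L \<inter> vert (convex hull (H \<inter> \<int> \<times> \<int>)) \<noteq> {}))"
proof -
  define f where "f = (\<lambda>i. {z. w1 \<bullet> (z - z0) = first_level w1 z0 + real i})"
  have "setdist A (f i) = (first_level w1 z0 + real i) / norm w1" for i
    unfolding A f_def using primitive_nonzero[OF assms(1)] first_level_bounds(1)[of w1 z0]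
    by (intro setdist_parallel_hyperplanes) linarith+
  then have "strict_mono (\<lambda>i. setdist A (f i))"
    using primitive_nonzero[OF assms(1)] by (auto simp: strict_mono_def divide_strict_right_mono)
  moreover have "lattice_lines A H = range f"
    unfolding A H f_def by (rule lattice_lines_branch[OF assms(1-3)])
  ultimately have closest: "closest_members N A (lattice_lines A H) S \<longleftrightarrow> S = f ` {..<N}" for S
    using closest_members_range by simp
  have "f i \<inter> vert (convex hull (H \<inter> \<int> \<times> \<int>)) \<noteq> {}" if "i < N" for i
    using level_contains_vertex[OF assms(1-4) that, of z0] unfolding H f_def by blast
  then show ?thesis unfolding closest by auto
qed

section \<open>Finiteness of the vertex set\<close>

lemma extreme_point_not_midpoint:
  assumes "p extreme_point_of (convex hull S)" "p + u \<in> S" "p - u \<in> S"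
  shows "u = 0"
proof (rule ccontr)
  assume "u \<noteq> 0"
  moreover have "(p + u) - (p - u) = 2 *\<^sub>R u" by (simp add: scaleR_2)
  ultimately have "p + u \<noteq> p - u" by (metis diff_self scaleR_eq_0_iff zero_neq_numeral)
  moreover have "p = midpoint (p + u) (p - u)"
    by (simp add: midpoint_def flip: scaleR_2)
  ultimately have "p \<in> open_segment (p + u) (p - u)" by (metis midpoint_in_open_segment)
  then show False using assms hull_inc[of _ S convex] unfolding extreme_point_of_def by blast
qed

text \<open>A lattice step \<open>u\<close> along the level line of \<open>w2\<close> changes
  \<open>w1\<close> by the determinant. Adding it keeps \<open>p\<close> in the branch. Since
  \<open>w2\<close> is at least \<open>first_level w2 z0\<close> at \<open>p\<close>, subtracting it
  would also do so beyond the bound, making \<open>p\<close> a midpoint.\<close>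

lemma vertex_level_bound:
  assumes lat: "w1 \<in> \<int> \<times> \<int>" "w2 \<in> \<int> \<times> \<int>" and det: "det2 w1 w2 \<noteq> 0" and m: "m > 0"
    and p: "p \<in> vert (convex hull (branch w1 w2 z0 m \<inter> \<int> \<times> \<int>))"
  shows "w1 \<bullet> (p - z0) \<le> \<bar>det2 w1 w2\<bar> + m / first_level w2 z0"
proof (rule ccontr)
  let ?S = "branch w1 w2 z0 m \<inter> \<int> \<times> \<int>" and ?D = "\<bar>det2 w1 w2\<bar>" and ?s = "first_level w2 z0"
  assume neg: "\<not> ?thesis"
  have ext: "p extreme_point_of (convex hull ?S)" using p by (simp add: vert_def)
  then have "p \<in> ?S" by (rule extreme_point_of_convex_hull)
  then have p1: "0 < w1 \<bullet> (p - z0)" and pm: "m \<le> (w1 \<bullet> (p - z0)) * (w2 \<bullet> (p - z0))"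
    and pl: "p \<in> \<int> \<times> \<int>" by (auto simp: branch_def)
  have p2: "0 < w2 \<bullet> (p - z0)" using p1 pm m by (metis less_le_trans zero_less_mult_pos)
  obtain i where "w2 \<bullet> (p - z0) = ?s + real i"
    using positive_lattice_level[OF lat(2) pl p2] .
  then have s: "?s \<le> w2 \<bullet> (p - z0)" by simp
  have s0: "?s > 0" by (rule first_level_bounds)
  define u where "u = sgn (det2 w1 w2) *\<^sub>R (snd w2, - fst w2)"
  have u: "u \<in> \<int> \<times> \<int>" using lat by (auto simp: u_def sgn_if)
  have w1u: "w1 \<bullet> u = ?D"
    by (simp add: u_def inner_prod_def det2_def sgn_if abs_if algebra_simps)
  have w2u: "w2 \<bullet> u = 0" by (simp add: u_def inner_prod_def)
  have "u \<noteq> 0" using w1u det by auto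
  have "p + u \<in> ?S"
  proof -
    have "m \<le> (w1 \<bullet> (p - z0) + ?D) * (w2 \<bullet> (p - z0))"
      using pm p2 by (simp add: distrib_right add_increasing2)
    moreover have "w \<bullet> (p + u - z0) = w \<bullet> (p - z0) + w \<bullet> u" for w
      by (simp add: inner_diff_right inner_add_right)
    ultimately show ?thesis
      using p1 pl u w1u w2u by (auto simp: branch_def mem_Times_iff)
  qed
  moreover have "p - u \<in> ?S"
  proof -
    have "m / ?s < w1 \<bullet> (p - z0) - ?D" using neg by linarith
    moreover have "0 < m / ?s" using m s0 by simp
    ultimately have pos: "0 < w1 \<bullet> (p - z0) - ?D" "m < (w1 \<bullet> (p - z0) - ?D) * ?s"
      using s0 by (linarith, simp add: divide_less_eq)
    have "(w1 \<bullet> (p - z0) - ?D) * ?s \<le> (w1 \<bullet> (p - z0) - ?D) * (w2 \<bullet> (p - z0))"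
      using s pos(1) by (intro mult_left_mono) auto
    then have "m \<le> (w1 \<bullet> (p - z0) - ?D) * (w2 \<bullet> (p - z0))" using pos(2) by linarith
    moreover have "w \<bullet> (p - u - z0) = w \<bullet> (p - z0) - w \<bullet> u" for w
      by (simp add: inner_diff_right)
    ultimately show ?thesis
      using pos(1) pl u w1u w2u by (auto simp: branch_def mem_Times_iff)
  qed
  ultimately have "u = 0" by (rule extreme_point_not_midpoint[OF ext])
  then show False using \<open>u \<noteq> 0\<close> by simp
qed

lemma finite_lattice_bounded:
  assumes "bounded (X :: (real \<times> real) set)"
  shows "finite (X \<inter> \<int> \<times> \<int>)"
proof -
  obtain B where B: "\<And>z. z \<in> X \<Longrightarrow> norm z \<le> B" using assms by (auto simp: bounded_iff)
  have "X \<inter> \<int> \<times> \<int> \<subseteq> {x \<in> \<int>. - B \<le> x \<and> x \<le> B} \<times> {x \<in> \<int>. - B \<le> x \<and> x \<le> B}"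
  proof
    fix z assume z: "z \<in> X \<inter> \<int> \<times> \<int>"
    have "\<bar>fst z\<bar> \<le> B" "\<bar>snd z\<bar> \<le> B"
      using B[of z] z norm_fst_le[of "fst z" "snd z"] norm_snd_le[of "snd z" "fst z"] by auto
    then show "z \<in> {x \<in> \<int>. - B \<le> x \<and> x \<le> B} \<times> {x \<in> \<int>. - B \<le> x \<and> x \<le> B}"
      using z by (auto simp: mem_Times_iff)
  qed
  then show ?thesis by (rule finite_subset) (intro finite_cartesian_product finite_int_segment)
qed

lemma bounded_two_levels:
  assumes "det2 w1 w2 \<noteq> 0"
  shows "bounded {z. \<bar>w1 \<bullet> (z - z0)\<bar> \<le> B1 \<and> \<bar>w2 \<bullet> (z - z0)\<bar> \<le> B2}"
proof -
  let ?D = "\<bar>det2 w1 w2\<bar>"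
  \<comment> \<open>The two summands bound the coordinates of \<open>z - z0\<close> by Cramer's
    rule.\<close>
  define T where "T = (\<bar>snd w2\<bar> * B1 + \<bar>snd w1\<bar> * B2) / ?D + (\<bar>fst w1\<bar> * B2 + \<bar>fst w2\<bar> * B1) / ?D"
  have "dist z0 z \<le> T" if z: "\<bar>w1 \<bullet> (z - z0)\<bar> \<le> B1" "\<bar>w2 \<bullet> (z - z0)\<bar> \<le> B2" for z
  proof -
    define y where "y = z - z0"
    have lin: "\<bar>\<alpha> * (w1 \<bullet> y) - \<beta> * (w2 \<bullet> y)\<bar> \<le> \<bar>\<alpha>\<bar> * B1 + \<bar>\<beta>\<bar> * B2" for \<alpha> \<beta>
    proof -
      have "\<bar>\<alpha> * (w1 \<bullet> y) - \<beta> * (w2 \<bullet> y)\<bar> \<le> \<bar>\<alpha>\<bar> * \<bar>w1 \<bullet> y\<bar> + \<bar>\<beta>\<bar> * \<bar>w2 \<bullet> y\<bar>"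
        by (metis abs_mult abs_triangle_ineq4)
      also have "\<dots> \<le> \<bar>\<alpha>\<bar> * B1 + \<bar>\<beta>\<bar> * B2"
        using z unfolding y_def by (intro add_mono mult_left_mono) auto
      finally show ?thesis .
    qed
    have "det2 w1 w2 * fst y = snd w2 * (w1 \<bullet> y) - snd w1 * (w2 \<bullet> y)"
      "det2 w1 w2 * snd y = - fst w2 * (w1 \<bullet> y) - (- fst w1) * (w2 \<bullet> y)"
      by (simp_all add: det2_def inner_prod_def algebra_simps)
    then have "?D * \<bar>fst y\<bar> \<le> \<bar>snd w2\<bar> * B1 + \<bar>snd w1\<bar> * B2"
      "?D * \<bar>snd y\<bar> \<le> \<bar>fst w2\<bar> * B1 + \<bar>fst w1\<bar> * B2"
      using lin[of "snd w2" "snd w1"] lin[of "- fst w2" "- fst w1"] by (simp_all flip: abs_mult)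
    then have "\<bar>fst y\<bar> + \<bar>snd y\<bar> \<le> T"
      unfolding T_def using assms by (intro add_mono) (simp_all add: le_divide_eq mult.commute add.commute)
    moreover have "norm y \<le> \<bar>fst y\<bar> + \<bar>snd y\<bar>"
      using norm_Pair_le[of "fst y" "snd y"] by simp
    ultimately show ?thesis by (simp add: dist_norm y_def norm_minus_commute)
  qed
  then show ?thesis unfolding bounded_def by blast
qed

text \<open>Lower bounds on \<open>card\<close> depend on this, since \<open>card\<close> of an
  infinite set is 0. Both coordinates of a vertex are bounded, the second by exchanging the
  factors.\<close>

lemma finite_vert_branch:
  assumes lat: "w1 \<in> \<int> \<times> \<int>" "w2 \<in> \<int> \<times> \<int>" and det: "det2 w1 w2 \<noteq> 0" and m: "m > 0"
  shows "finite (vert (convex hull (branch w1 w2 z0 m \<inter> \<int> \<times> \<int>)))" (is "finite ?V")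
proof -
  let ?B1 = "\<bar>det2 w1 w2\<bar> + m / first_level w2 z0" and ?B2 = "\<bar>det2 w1 w2\<bar> + m / first_level w1 z0"
  have "?V \<subseteq> {z. \<bar>w1 \<bullet> (z - z0)\<bar> \<le> ?B1 \<and> \<bar>w2 \<bullet> (z - z0)\<bar> \<le> ?B2} \<inter> \<int> \<times> \<int>"
  proof
    fix p assume p: "p \<in> ?V"
    then have pS: "p \<in> branch w1 w2 z0 m \<inter> \<int> \<times> \<int>"
      by (auto simp: vert_def dest: extreme_point_of_convex_hull)
    then have "0 < w1 \<bullet> (p - z0)" by (auto simp: branch_def)
    moreover have "0 < w2 \<bullet> (p - z0)"
      using pS unfolding branch_swap[OF m, of w1] by (auto simp: branch_def)
    moreover have "w1 \<bullet> (p - z0) \<le> ?B1"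
      by (rule vertex_level_bound[OF lat det m p])
    moreover have "w2 \<bullet> (p - z0) \<le> ?B2"
      using vertex_level_bound[of w2 w1 m p z0] lat det m p branch_swap[OF m, of w1] det2_swap[of w2 w1]
      by (metis abs_eq_0)
    ultimately show "p \<in> {z. \<bar>w1 \<bullet> (z - z0)\<bar> \<le> ?B1 \<and> \<bar>w2 \<bullet> (z - z0)\<bar> \<le> ?B2} \<inter> \<int> \<times> \<int>"
      using pS by auto
  qed
  then show ?thesis
    using finite_lattice_bounded[OF bounded_two_levels[OF det]] by (rule finite_subset)
qed

section \<open>Counting the vertices\<close>

text \<open>Vertices on different levels are distinct, and the first \<open>N\<close> levels are at
  most \<open>N\<close>. The bound on the level is what later separates the vertices of the two
  asymptotes.\<close>

lemma card_vertices_near_asymptote: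
  assumes w1: "primitive w1" and w2: "w2 \<in> \<int> \<times> \<int>" and det: "det2 w1 w2 \<noteq> 0" and m: "m > 0"
    and N: "real N ^ 3 * \<bar>det2 w1 w2\<bar> \<le> m"
  shows "N \<le> card {p \<in> vert (convex hull (branch w1 w2 z0 m \<inter> \<int> \<times> \<int>)). w1 \<bullet> (p - z0) \<le> real N}"
    (is "_ \<le> card ?V")
proof -
  let ?f = "\<lambda>i::nat. first_level w1 z0 + real i"
  have "finite ?V" using finite_vert_branch[OF primitive_imp_lattice[OF w1] w2 det m] by simp
  moreover have "?f ` {..<N} \<subseteq> (\<lambda>p. w1 \<bullet> (p - z0)) ` ?V"
  proof
    fix d assume "d \<in> ?f ` {..<N}"
    then obtain i where i: "i < N" "d = ?f i" by auto
    then obtain p where "p \<in> vert (convex hull (branch w1 w2 z0 m \<inter> \<int> \<times> \<int>))" "w1 \<bullet> (p - z0) = d"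
      using level_contains_vertex[OF w1 det m N i(1)] by blast
    moreover have "d \<le> real N" using i first_level_bounds(2)[of w1 z0] by linarith
    ultimately show "d \<in> (\<lambda>p. w1 \<bullet> (p - z0)) ` ?V" by blast
  qed
  ultimately have "card (?f ` {..<N}) \<le> card ?V" by (rule surj_card_le)
  moreover have "card (?f ` {..<N}) = N" by (simp add: card_image inj_on_def)
  ultimately show ?thesis by simp
qed

lemma card_vert_branch_ge:
  assumes w1: "primitive w1" and w2: "primitive w2" and det: "det2 w1 w2 \<noteq> 0"
    and r: "r \<ge> 0" and m: "m > 0" "m = r ^ 3 * \<bar>det2 w1 w2\<bar>"
  shows "2 * r - 2 \<le> real (card (vert (convex hull (branch w1 w2 z0 m \<inter> \<int> \<times> \<int>))))"
    (is "_ \<le> real (card ?V)")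
proof (cases "r \<le> 1")
  \<comment> \<open>The lower bound is not positive here.\<close>
  case True
  then show ?thesis by (smt (verit) of_nat_0_le_iff)
next
  case False
  define N where "N = nat \<lfloor>r\<rfloor>"
  have Nr: "real N \<le> r" "r < real N + 1" using r unfolding N_def by linarith+
  have D: "1 \<le> \<bar>det2 w1 w2\<bar>"
    using abs_det2_ge_1[OF primitive_imp_lattice[OF w1] primitive_imp_lattice[OF w2] det] .
  have N: "real N ^ 3 * \<bar>det2 w1 w2\<bar> \<le> m"
    unfolding m(2) using Nr by (intro mult_right_mono power_mono) auto
  have det': "det2 w2 w1 \<noteq> 0" using det det2_swap[of w1 w2] by auto
  let ?V1 = "{p \<in> ?V. w1 \<bullet> (p - z0) \<le> real N}" and ?V2 = "{p \<in> ?V. w2 \<bullet> (p - z0) \<le> real N}"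
  have "N \<le> card ?V1"
    using card_vertices_near_asymptote[OF w1 primitive_imp_lattice[OF w2] det m(1) N] .
  moreover have "N \<le> card ?V2"
    unfolding branch_swap[OF m(1), of w1]
    using card_vertices_near_asymptote[OF w2 primitive_imp_lattice[OF w1] det' m(1)] N
    by (simp add: det2_swap)
  moreover have "?V1 \<inter> ?V2 = {}"
  proof (rule ccontr)
    assume "?V1 \<inter> ?V2 \<noteq> {}"
    then obtain p where p: "p \<in> ?V" "w1 \<bullet> (p - z0) \<le> real N" "w2 \<bullet> (p - z0) \<le> real N" by blast
    have "p \<in> branch w1 w2 z0 m"
      using p(1) by (auto simp: vert_def dest: extreme_point_of_convex_hull)
    then have pm: "0 < w1 \<bullet> (p - z0)" "m \<le> (w1 \<bullet> (p - z0)) * (w2 \<bullet> (p - z0))"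
      by (auto simp: branch_def)
    \<comment> \<open>The contradiction is \<open>m \<le> r\<^sup>2 < r ^ 3 \<le> m\<close>, from
      \<open>r > 1\<close> and a determinant of absolute value at least 1.\<close>
    have "m \<le> (w1 \<bullet> (p - z0)) * real N"
      using pm p(3) by (meson less_imp_le mult_left_mono order_trans)
    also have "\<dots> \<le> r * r"
      using pm p(2) Nr r by (intro mult_mono) auto
    also have "\<dots> < r ^ 3 * 1" using False by (simp add: power3_eq_cube)
    also have "\<dots> \<le> r ^ 3 * \<bar>det2 w1 w2\<bar>" using D r by (intro mult_left_mono) auto
    finally show False using m(2) by simp
  qed
  moreover have fin: "finite ?V"
    using finite_vert_branch[OF primitive_imp_lattice[OF w1] primitive_imp_lattice[OF w2] det m(1)] .
  moreover have "card (?V1 \<union> ?V2) \<le> card ?V" using fin by (intro card_mono) auto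
  ultimately have "2 * N \<le> card ?V" by (simp add: card_Un_disjoint)
  then have "2 * real N \<le> real (card ?V)" by linarith
  then show ?thesis using Nr by linarith
qed

section \<open>Reduction of the theorem to linear coordinates\<close>

theorem theorem2p8:
  fixes a b c n x0 y0 \<Delta> :: real and h C H :: "(real \<times> real) set"
  assumes "n \<noteq> 0"
    and "\<Delta> = sqrt (b\<^sup>2 - 4 * a * c)" and "\<Delta> > 0"
    and "a \<in> \<int>" and "b \<in> \<int>" and "c \<in> \<int>" and "\<Delta> \<in> \<int>"
    and "h = hyperbola a b c n x0 y0"
    and "C \<in> components (UNIV - h)" and "convex C" and "H = closure C"
  shows "(\<forall>A. A asymptote_of h \<longrightarrow>
            (\<exists>S. closest_members (nat \<lfloor>root 3 (\<bar>n\<bar> / \<Delta>)\<rfloor>) A (lattice_lines A H) S) \<and>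
            (\<forall>S. closest_members (nat \<lfloor>root 3 (\<bar>n\<bar> / \<Delta>)\<rfloor>) A (lattice_lines A H) S \<longrightarrow>
              (\<forall>L\<in>S. L \<inter> vert (convex hull (H \<inter> \<int> \<times> \<int>)) \<noteq> {}))) \<and>
         real (card (vert (convex hull (H \<inter> \<int> \<times> \<int>)))) \<ge> 2 * root 3 (\<bar>n\<bar> / \<Delta>) - 2"
proof -
  define z0 where "z0 = (x0, y0)"
  obtain v1 v2 k where v: "primitive v1" "primitive v2" and k: "k \<noteq> 0"
    and \<Delta>: "\<Delta> = \<bar>k\<bar> * \<bar>det2 v1 v2\<bar>"
    and form: "\<And>u v. a * u\<^sup>2 + b * u * v + c * v\<^sup>2 = k * (v1 \<bullet> (u, v)) * (v2 \<bullet> (u, v))"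
    using quadratic_form_factorization assms(2-7) by metis
  define m where "m = \<bar>n\<bar> / \<bar>k\<bar>"
  have m: "m > 0" using assms(1) k by (simp add: m_def)
  have h_v: "h = {z. (v1 \<bullet> (z - z0)) * (v2 \<bullet> (z - z0)) = n / k}"
    unfolding assms(8) hyperbola_def form z0_def using k by (auto simp: field_simps)
  \<comment> \<open>The sign of \<open>n / k\<close> is absorbed into the second factor, so that the
    right-hand side becomes the positive \<open>m\<close>.\<close>
  define v3 where "v3 = sgn (n / k) *\<^sub>R v2"
  have sgn: "sgn (n / k) = 1 \<and> n / k = m \<or> sgn (n / k) = - 1 \<and> n / k = - m"
    using assms(1) k unfolding m_def by (auto simp: sgn_if abs_if field_simps)
  have v3: "primitive v3" using sgn v(2) primitive_uminus[OF v(2)] by (auto simp: v3_def)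
  have det_v3: "\<bar>det2 v1 v3\<bar> = \<bar>det2 v1 v2\<bar>"
    using sgn by (auto simp: v3_def det2_def abs_minus_commute)
  have h_v3: "h = {z. (v1 \<bullet> (z - z0)) * (v3 \<bullet> (z - z0)) = m}"
    using sgn unfolding h_v v3_def by auto
  have "det2 v1 v3 \<noteq> 0" using \<Delta> assms(3) det_v3 by auto
  then consider "C = open_branch v1 v3 z0 m" | "C = open_branch (- v1) (- v3) z0 m"
    using convex_component_hyperbola[OF m _ h_v3 assms(9,10)] by blast
  \<comment> \<open>Negating both vectors for the opposite branch preserves \<open>h\<close> and the
    determinant.\<close>
  then obtain w1 w2 where w: "primitive w1" "primitive w2" and det_w: "\<bar>det2 w1 w2\<bar> = \<bar>det2 v1 v2\<bar>"
    and h_w: "h = {z. (w1 \<bullet> (z - z0)) * (w2 \<bullet> (z - z0)) = m}"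
    and C_w: "C = open_branch w1 w2 z0 m"
  proof cases
    case 1
    then show ?thesis using that[of v1 v3] v(1) v3 det_v3 h_v3 by blast
  next
    case 2
    have "\<bar>det2 (- v1) (- v3)\<bar> = \<bar>det2 v1 v2\<bar>" using det_v3 by (simp add: det2_def)
    moreover have "h = {z. (- v1 \<bullet> (z - z0)) * (- v3 \<bullet> (z - z0)) = m}" using h_v3 by simp
    ultimately show ?thesis
      using that[of "- v1" "- v3"] v(1) v3 2 primitive_uminus by blast
  qed
  have det: "det2 w1 w2 \<noteq> 0" using \<Delta> assms(3) det_w by auto
  have H: "H = branch w1 w2 z0 m" unfolding assms(11) C_w by (rule closure_open_branch[OF m])
  define r where "r = root 3 (\<bar>n\<bar> / \<Delta>)"
  have r0: "r \<ge> 0" using assms(3) by (simp add: r_def)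
  have "r ^ 3 = \<bar>n\<bar> / \<Delta>" unfolding r_def using assms(3) by (intro real_root_pow_pos2) auto
  \<comment> \<open>The factor \<open>\<bar>k\<bar>\<close> occurs in both \<open>m\<close> and
    \<Delta> and cancels.\<close>
  then have mr: "m = r ^ 3 * \<bar>det2 w1 w2\<bar>"
    using det k by (simp add: \<Delta> m_def det_w[symmetric])
  define N where "N = nat \<lfloor>r\<rfloor>"
  have "real N \<le> r" using r0 unfolding N_def by linarith
  then have N: "real N ^ 3 * \<bar>det2 w1 w2\<bar> \<le> m"
    unfolding mr by (intro mult_right_mono power_mono) auto
  have det': "det2 w2 w1 \<noteq> 0" using det det2_swap[of w1 w2] by auto
  have "(\<exists>S. closest_members N A (lattice_lines A H) S) \<and>
    (\<forall>S. closest_members N A (lattice_lines A H) S \<longrightarrow>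
      (\<forall>L\<in>S. L \<inter> vert (convex hull (H \<inter> \<int> \<times> \<int>)) \<noteq> {}))" if "A asymptote_of h" for A
    using asymptote_of_hyperbola[OF det h_w that]
  proof
    assume "A = {z. w1 \<bullet> (z - z0) = 0}"
    then show ?thesis using closest_lattice_lines_contain_vertices[OF w(1) det m N _ H] by blast
  next
    assume A: "A = {z. w2 \<bullet> (z - z0) = 0}"
    have N': "real N ^ 3 * \<bar>det2 w2 w1\<bar> \<le> m" using N by (simp add: det2_swap)
    \<comment> \<open>The second asymptote is treated by exchanging the factors.\<close>
    have "H = branch w2 w1 z0 m" unfolding H by (rule branch_swap[OF m])
    from closest_lattice_lines_contain_vertices[OF w(2) det' m N' A this] show ?thesis .
  qed
  moreover have "2 * r - 2 \<le> real (card (vert (convex hull (H \<inter> \<int> \<times> \<int>))))"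
    unfolding H by (rule card_vert_branch_ge[OF w det r0 m mr])
  ultimately show ?thesis unfolding N_def r_def by blast
qed

end
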